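(* Let $n$ be an odd integer. If an edge-coloring of a complete graph contains no rainbow $n$-cycle, then it contains no rainbow $m$-cycle for every integer $m \ge 2n^2$.
   Context: A coloring is an arbitrary (not necessarily proper) assignment of colors, from an arbitrary set, to the edges of an undirected complete graph; the graph may be finite or infinite. A rainbow $n$-cycle in a coloring is a cycle through $n$ distinct vertices whose $n$ edges all receive pairwise distinct colors. *)

theory Defs
  imports Main
begin

text \<open>An edge-colouring of the complete graph on vertex type 'a (finite or infinite)
 is any function from edges, i.e. two-element sets of vertices, to colours.
 Only its values on sets {x, y} with x \<noteq> y matter.\<close>

definition rainbow_cycle :: "('a set \<Rightarrow> 'c) \<Rightarrow> nat \<Rightarrow> bool" where
  "rainbow_cycle c n \<longleftrightarrow> 3 \<le> n \<and>
     (\<exists>v :: nat \<Rightarrow> 'a. inj_on v {..<n} \<and>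
        inj_on (\<lambda>i. c {v i, v ((i + 1) mod n)}) {..<n})"

end

theory Submission
  imports Defs
begin

text \<open>
  Write \<open>n = N + 2\<close> and let \<open>S\<close> be the set of \<open>s \<ge> 1\<close> such that no \<open>(s + 2)\<close>-cycle is rainbow.
  In a rainbow \<open>m\<close>-cycle with vertices \<open>i\<close> modulo \<open>m\<close>, let the edge from \<open>i\<close> to \<open>i + 1\<close> have
  colour \<open>i\<close>. As \<open>N \<in> S\<close>, the chord from \<open>i\<close> to \<open>i + N + 1\<close> has a colour in \<open>[i, i + N]\<close>;
  shortcutting along it shows \<open>s \<in> S \<Longrightarrow> s + N \<in> S\<close>.

  The key point is that \<open>s \<in> S\<close> implies \<open>s + 2 N - 2 \<in> S\<close> when \<open>s \<ge> 2 N + 5\<close>. Suppose there is a rainbow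
  cycle of length \<open>m = s + 2 N\<close>; it suffices to shorten it by \<open>2 N - 2\<close> edges. If the chords at \<open>i\<close>
  and at \<open>i + N\<close> both avoid the colour \<open>i + N\<close>, the detour \<open>i, i + N + 1, i + N, i + 2 N + 1\<close> does so.
  Otherwise, going around the cycle in steps of \<open>N\<close>, every chord at \<open>i\<close> has colour \<open>i\<close> or \<open>i + N\<close>.
  Let the chord at \<open>z\<close> have colour \<open>z\<close> (the other case is its mirror image), and put \<open>f = (N + 1) / 2\<close>
  and \<open>x = z - f + 1\<close>. Closing the path \<open>x, \<dots>, z, z + N + 1, z + N, \<dots>, x + N\<close> by the edge between \<open>x + N\<close>
  and \<open>x\<close> gives an \<open>n\<close>-cycle, so this edge has a colour in \<open>[x, z]\<close> or in \<open>[x + N, z + N]\<close>. In the first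
  case it can be used in the forward direction, and in the second case on the detour
  \<open>x - 1, x + N, x, x + 1, \<dots>, z, z + N + 1\<close>; either way \<open>N - 1\<close> edges are saved. Doing this at two
  places far apart saves \<open>2 N - 2\<close> edges.

  Hence \<open>j N + t (2 N - 2) \<in> S\<close> for \<open>j \<ge> 4\<close>. As \<open>N\<close> is odd, \<open>t < N\<close> can be chosen to reach every
  residue class modulo \<open>N\<close>.
\<close>

section \<open>Rainbow paths and their concatenation\<close>

text \<open>Besides the endpoints and the number \<open>k\<close> of edges, only bounding sets for
  the vertices and the colours are recorded. Concatenation and closing then reduce to set conditions
  on \<open>A\<close> and \<open>K\<close>.\<close>

definition rainbow_path ::
    "('a set \<Rightarrow> 'c) \<Rightarrow> 'a set \<Rightarrow> 'c set \<Rightarrow> 'a \<Rightarrow> 'a \<Rightarrow> nat \<Rightarrow> bool" where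
  "rainbow_path c A K u w k \<longleftrightarrow>
     (\<exists>p. p 0 = u \<and> p k = w \<and> inj_on p {..k} \<and> (\<forall>i\<le>k. p i \<in> A) \<and>
        inj_on (\<lambda>i. c {p i, p (Suc i)}) {..<k} \<and> (\<forall>i<k. c {p i, p (Suc i)} \<in> K))"

lemma rainbow_path_refl: "u \<in> A \<Longrightarrow> rainbow_path c A K u u 0"
  unfolding rainbow_path_def by (intro exI[of _ "\<lambda>_. u"]) auto

lemma rainbow_path_edge:
  assumes "u \<noteq> w" "u \<in> A" "w \<in> A" "c {u, w} \<in> K"
  shows "rainbow_path c A K u w (Suc 0)"
  unfolding rainbow_path_def using assms
  by (intro exI[of _ "\<lambda>i. if i = 0 then u else w"]) (auto simp: inj_on_def)

lemma rainbow_path_trans: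
  assumes "rainbow_path c A K u w k" "rainbow_path c A' K' w y k'"
    and A: "A \<inter> A' \<subseteq> {w}" and K: "K \<inter> K' = {}"
  shows "rainbow_path c (A \<union> A') (K \<union> K') u y (k + k')"
proof -
  obtain p where p: "p 0 = u" "p k = w" "inj_on p {..k}" "\<forall>i\<le>k. p i \<in> A"
      "inj_on (\<lambda>i. c {p i, p (Suc i)}) {..<k}" "\<forall>i<k. c {p i, p (Suc i)} \<in> K"
    using assms(1) unfolding rainbow_path_def by blast
  obtain r where r: "r 0 = w" "r k' = y" "inj_on r {..k'}" "\<forall>i\<le>k'. r i \<in> A'"
      "inj_on (\<lambda>i. c {r i, r (Suc i)}) {..<k'}" "\<forall>i<k'. c {r i, r (Suc i)} \<in> K'"
    using assms(2) unfolding rainbow_path_def by blast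
  define s where "s i = (if i \<le> k then p i else r (i - k))" for i
  have s1: "s i = p i" if "i \<le> k" for i using that by (simp add: s_def)
  have s2: "s (k + i) = r i" for i using p r by (simp add: s_def)
  have sep: "s i \<noteq> s (k + j)" if "i \<le> k" "0 < j" "j \<le> k'" for i j
  proof
    assume "s i = s (k + j)"
    then have "p i = r j" using that s1 s2 by simp
    moreover have "p i \<in> A" "r j \<in> A'" using that p r by auto
    ultimately have "r j = r 0" using A r by auto
    then show False using that r(3) by (auto simp: inj_on_def)
  qed
  have split: "i \<le> k \<or> (\<exists>j>0. i = k + j)" for i
    by (metis less_imp_add_positive not_le)
  have inj_s: "inj_on s {..k + k'}"
  proof (rule linorder_inj_onI)
    fix i j assume ij: "i < j" "i \<in> {..k + k'}" "j \<in> {..k + k'}"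
    show "s i \<noteq> s j"
    proof (cases "i \<le> k")
      case True
      show ?thesis
      proof (cases "j \<le> k")
        case True then show ?thesis using ij p(3) s1 by (auto simp: inj_on_def)
      next
        case False
        then obtain l where "l > 0" "j = k + l" using split by blast
        then show ?thesis using sep[of i l] \<open>i \<le> k\<close> ij by auto
      qed
    next
      case False
      then obtain a where a: "i = k + a" using split by blast
      obtain b where b: "j = k + b" using ij False split[of j] by auto
      show ?thesis using a b ij r(3) s2 by (auto simp: inj_on_def)
    qed
  qed auto
  have s_in: "s i \<in> A \<union> A'" if "i \<le> k + k'" for i
    using that split[of i] p(4) r(4) s1 s2 by auto
  have e1: "c {s i, s (Suc i)} = c {p i, p (Suc i)}" if "i < k" for i
    using that s1 by simp
  have e2: "c {s (k + i), s (Suc (k + i))} = c {r i, r (Suc i)}" for i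
    using s2[of i] s2[of "Suc i"] by simp
  have split': "i < k \<or> (\<exists>j. i = k + j)" for i
    by (metis le_iff_add not_le)
  have inj_c: "inj_on (\<lambda>i. c {s i, s (Suc i)}) {..<k + k'}"
  proof (rule linorder_inj_onI)
    fix i j assume ij: "i < j" "i \<in> {..<k + k'}" "j \<in> {..<k + k'}"
    show "c {s i, s (Suc i)} \<noteq> c {s j, s (Suc j)}"
    proof (cases "i < k")
      case True
      show ?thesis
      proof (cases "j < k")
        case True
        then show ?thesis using ij e1[of i] e1[of j] inj_onD[OF p(5), of i j] by auto
      next
        case False
        then obtain l where l: "j = k + l" using split' by blast
        then have "c {s j, s (Suc j)} \<in> K'" using e2[of l] r(6) ij by auto
        moreover have "c {s i, s (Suc i)} \<in> K" using e1[of i] p(6) True by auto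
        ultimately show ?thesis using K by auto
      qed
    next
      case False
      then obtain a where a: "i = k + a" using split' by blast
      obtain b where b: "j = k + b" using ij False split'[of j] by auto
      show ?thesis using a b ij e2[of a] e2[of b] inj_onD[OF r(5), of a b] by auto
    qed
  qed auto
  have c_in: "c {s i, s (Suc i)} \<in> K \<union> K'" if "i < k + k'" for i
    using split'[of i]
  proof
    assume "i < k" then show ?thesis using p(6) e1 by simp
  next
    assume "\<exists>j. i = k + j" then show ?thesis using that r(6) e2 by auto
  qed
  have "s 0 = u" "s (k + k') = y" using s1[of 0] s2[of k'] p r by auto
  with inj_s s_in inj_c c_in show ?thesis
    unfolding rainbow_path_def by (intro exI[of _ s] conjI allI impI)
qed

lemma rainbow_path_sym:
  assumes "rainbow_path c A K u w k"
  shows "rainbow_path c A K w u k"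
proof -
  obtain p where p: "p 0 = u" "p k = w" "inj_on p {..k}" "\<forall>i\<le>k. p i \<in> A"
      "inj_on (\<lambda>i. c {p i, p (Suc i)}) {..<k}" "\<forall>i<k. c {p i, p (Suc i)} \<in> K"
    using assms unfolding rainbow_path_def by blast
  define s where "s i = p (k - i)" for i
  have e: "c {s i, s (Suc i)} = c {p (k - Suc i), p (Suc (k - Suc i))}" if "i < k" for i
    using that by (simp add: s_def insert_commute Suc_diff_Suc)
  have "inj_on s {..k}"
    by (auto simp: s_def intro!: inj_onI dest!: inj_onD[OF p(3)])
  moreover have "\<forall>i\<le>k. s i \<in> A" using p(4) by (auto simp: s_def)
  moreover have "inj_on (\<lambda>i. c {s i, s (Suc i)}) {..<k}"
  proof (rule inj_onI)
    fix i j assume ij: "i \<in> {..<k}" "j \<in> {..<k}" "c {s i, s (Suc i)} = c {s j, s (Suc j)}"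
    then have "k - Suc i = k - Suc j"
      using e[of i] e[of j] inj_onD[OF p(5), of "k - Suc i" "k - Suc j"] by auto
    then show "i = j" using ij by auto
  qed
  moreover have "\<forall>i<k. c {s i, s (Suc i)} \<in> K"
    using p(6) e by auto
  ultimately show ?thesis unfolding rainbow_path_def
    using p(1,2) by (intro exI[of _ s]) (auto simp: s_def)
qed

lemma rainbow_path_mono:
  "rainbow_path c A K u w k \<Longrightarrow> A \<subseteq> A' \<Longrightarrow> K \<subseteq> K' \<Longrightarrow> rainbow_path c A' K' u w k"
  unfolding rainbow_path_def by blast

lemma rainbow_path_close:
  assumes "rainbow_path c A K u w k" "2 \<le> k" "c {w, u} \<notin> K"
  shows "rainbow_cycle c (Suc k)"
proof -
  obtain p where p: "p 0 = u" "p k = w" "inj_on p {..k}" "\<forall>i\<le>k. p i \<in> A"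
      "inj_on (\<lambda>i. c {p i, p (Suc i)}) {..<k}" "\<forall>i<k. c {p i, p (Suc i)} \<in> K"
    using assms unfolding rainbow_path_def by blast
  let ?e = "\<lambda>i. c {p i, p ((i + 1) mod Suc k)}"
  have e: "?e i = c {p i, p (Suc i)}" if "i < k" for i using that by simp
  have "inj_on ?e {..<k}"
    using p(5) e by (simp add: inj_on_def)
  moreover have "?e k \<notin> ?e ` {..<k}"
    using p assms(3) e by (auto simp: image_iff)
  ultimately have "inj_on ?e {..<Suc k}"
    by (simp add: lessThan_Suc)
  then show ?thesis
    unfolding rainbow_cycle_def using assms(2) p(3) by (auto simp: lessThan_Suc_atMost)
qed

section \<open>A rainbow cycle unrolled along the integers\<close>

text \<open>Indexing by all integers, with period \<open>m\<close>, makes translations free and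
  turns reversal of the cycle into negation of the index.\<close>

locale periodic_rainbow_cycle =
  fixes c :: "'a set \<Rightarrow> 'c" and m :: nat and V :: "int \<Rightarrow> 'a"
  assumes V_eq_iff: "V i = V j \<longleftrightarrow> int m dvd i - j"
    and color_eq_iff: "c {V i, V (i + 1)} = c {V j, V (j + 1)} \<longleftrightarrow> int m dvd i - j"
begin

definition col :: "int \<Rightarrow> 'c" where "col i = c {V i, V (i + 1)}"

definition path :: "int set \<Rightarrow> int set \<Rightarrow> int \<Rightarrow> int \<Rightarrow> nat \<Rightarrow> bool" where
  "path A K u w k \<longleftrightarrow> rainbow_path c (V ` A) (col ` K) (V u) (V w) k"

lemma small_dvd:
  assumes "int m dvd i - j" "i \<in> {l..<l + int m}" "j \<in> {l..<l + int m}"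
  shows "i = j"
proof (rule ccontr)
  assume "i \<noteq> j"
  then have "int m \<le> \<bar>i - j\<bar>" using assms(1) dvd_imp_le_int[of "i - j" "int m"] by simp
  then show False using assms(2,3) by auto
qed

lemma V_inj: "inj_on V {l..<l + int m}"
  by (rule inj_onI) (metis V_eq_iff small_dvd)

lemma col_inj: "inj_on col {l..<l + int m}"
  by (rule inj_onI) (metis col_def color_eq_iff small_dvd)

lemma path_refl: "u \<in> A \<Longrightarrow> path A K u u 0"
  unfolding path_def by (auto intro: rainbow_path_refl)

lemma path_sym: "path A K u w k \<Longrightarrow> path A K w u k"
  unfolding path_def by (rule rainbow_path_sym)

lemma path_mono:
  assumes "path A K u w k" "A \<subseteq> A'" "K \<subseteq> K'" "u = u'" "w = w'" "k = k'"
  shows "path A' K' u' w' k'"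
  using rainbow_path_mono[of c "V ` A" "col ` K" "V u" "V w" k "V ` A'" "col ` K'"] assms
  unfolding path_def by (simp add: image_mono)

lemma path_edge:
  assumes "c {V u, V w} = col j" "u < w" "w < u + int m"
  shows "path {u, w} {j} u w 1"
proof -
  have "V u \<noteq> V w" using small_dvd[of u w u] assms unfolding V_eq_iff by auto
  then show ?thesis unfolding path_def using assms by (auto intro!: rainbow_path_edge)
qed

text \<open>On a window of \<open>m\<close> consecutive indices \<open>V\<close> and
  \<open>col\<close> are injective, so disjointness of vertices and colours becomes a statement
  about integers.\<close>

lemma path_trans:
  assumes "path A K u w k" "path A' K' w y k'"
    and "A \<union> A' \<union> K \<union> K' \<subseteq> {l..<l + int m}"
    and "A \<inter> A' \<subseteq> {w}" and "K \<inter> K' = {}"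
  shows "path (A \<union> A') (K \<union> K') u y (k + k')"
proof -
  have "V ` A \<inter> V ` A' = V ` (A \<inter> A')" "col ` K \<inter> col ` K' = col ` (K \<inter> K')"
    using assms(3) inj_on_image_Int[OF V_inj[of l], of A A']
      inj_on_image_Int[OF col_inj[of l], of K K'] by auto
  then show ?thesis
    using rainbow_path_trans[of c "V ` A" "col ` K" "V u" "V w" k "V ` A'" "col ` K'" "V y" k'] assms
    unfolding path_def by (auto simp: image_Un)
qed

lemma path_run:
  assumes "k < m"
  shows "path {i..i + int k} {i..<i + int k} i (i + int k) k"
  using assms
proof (induction k)
  case 0 then show ?case by (auto intro: path_refl)
next
  case (Suc k)
  have "path {i + int k, i + int k + 1} {i + int k} (i + int k) (i + int k + 1) 1"
    using Suc by (intro path_edge) (auto simp: col_def)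
  then have "path ({i..i + int k} \<union> {i + int k, i + int k + 1}) ({i..<i + int k} \<union> {i + int k})
      i (i + int k + 1) (k + 1)"
    using Suc by (intro path_trans[of _ _ _ "i + int k" _ _ _ _ _ i]) auto
  then show ?case by (rule path_mono) auto
qed

lemma path_close:
  assumes "path A K u w k" "2 \<le> k" "c {V w, V u} \<notin> col ` K"
  shows "rainbow_cycle c (Suc k)"
  using assms unfolding path_def by (rule rainbow_path_close)

lemma col_notin: "j \<notin> K \<Longrightarrow> insert j K \<subseteq> {l..<l + int m} \<Longrightarrow> col j \<notin> col ` K"
  using inj_on_image_mem_iff[OF col_inj[of l], of j K] by auto

lemma closing_color: "c {V (i + int m - 1), V i} = col (i + int m - 1)"
proof -
  have "V i = V (i + int m - 1 + 1)" by (simp add: V_eq_iff)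
  then show ?thesis unfolding col_def by simp
qed

section \<open>Colours of the chords spanning \<open>N + 1\<close> edges\<close>

text \<open>The chord closes a rainbow run of \<open>N + 1\<close> edges to a cycle of the omitted
  length \<open>N + 2\<close>, so it must repeat a colour of the run.\<close>

lemma chord_color:
  assumes "\<not> rainbow_cycle c (N + 2)" "1 \<le> N" "N + 2 \<le> m"
  obtains j where "i \<le> j" "j \<le> i + int N" "c {V i, V (i + int N + 1)} = col j"
proof -
  have "path {i..i + int (N + 1)} {i..<i + int (N + 1)} i (i + int (N + 1)) (N + 1)"
    using assms by (intro path_run) auto
  then have "c {V (i + int (N + 1)), V i} \<in> col ` {i..<i + int (N + 1)}"
    using path_close[of _ _ i "i + int (N + 1)" "N + 1"] assms(1,2) by force
  then obtain j where "j \<in> {i..<i + int (N + 1)}" "c {V (i + int (N + 1)), V i} = col j"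
    by blast
  moreover have "i + int (N + 1) = i + int N + 1" by simp
  ultimately show ?thesis using that[of j] by (simp add: insert_commute add_ac)
qed

lemma color_at_overlap:
  assumes "\<not> rainbow_cycle c (N + 2)" "1 \<le> N"
    and "\<not> rainbow_cycle c (s + 2)" "m = s + 2 * N" "2 \<le> s"
  shows "c {V i, V (i + int N + 1)} = col (i + int N) \<or>
    c {V (i + int N), V (i + 2 * int N + 1)} = col (i + int N)"
proof (rule ccontr)
  assume no: "\<not> ?thesis"
  obtain a where a: "i \<le> a" "a \<le> i + int N" "c {V i, V (i + int N + 1)} = col a"
    using chord_color[of N i] assms by auto
  obtain b where b: "i + int N \<le> b" "b \<le> i + 2 * int N"
      "c {V (i + int N), V (i + 2 * int N + 1)} = col b"
    using chord_color[of N "i + int N"] assms by (auto simp: add_ac)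
  \<comment> \<open>The two colour ranges share only \<open>i + N\<close>, which is excluded, so the
    three edges of the detour get distinct colours.\<close>
  have ab: "a < i + int N" "i + int N < b" using a b no by (force simp: order_less_le)+
  have P1: "path {i, i + int N + 1} {a} i (i + int N + 1) 1"
    using a assms by (intro path_edge) auto
  have P2: "path {i + int N, i + int N + 1} {i + int N} (i + int N + 1) (i + int N) 1"
    using assms by (intro path_sym[OF path_edge]) (auto simp: col_def)
  have P3: "path {i + int N, i + 2 * int N + 1} {b} (i + int N) (i + 2 * int N + 1) 1"
    using b assms by (intro path_edge) auto
  have P4: "path {i + 2 * int N + 1..i + int m - 1} {i + 2 * int N + 1..<i + int m - 1}
      (i + 2 * int N + 1) (i + int m - 1) (s - 2)"
    using path_run[of "s - 2" "i + 2 * int N + 1"] assms by (simp add: of_nat_diff algebra_simps)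
  note Q1 = path_trans[OF P1 P2, of i]
  note Q2 = path_trans[OF Q1 P3, of i]
  note Q3 = path_trans[OF Q2 P4, of i]
  have "path ({i, i + int N + 1} \<union> {i + int N, i + int N + 1} \<union> {i + int N, i + 2 * int N + 1} \<union>
      {i + 2 * int N + 1..i + int m - 1}) ({a} \<union> {i + int N} \<union> {b} \<union> {i + 2 * int N + 1..<i + int m - 1})
      i (i + int m - 1) (1 + 1 + 1 + (s - 2))"
    using ab a b assms by (intro Q3) auto
  moreover have "c {V (i + int m - 1), V i} \<notin>
      col ` ({a} \<union> {i + int N} \<union> {b} \<union> {i + 2 * int N + 1..<i + int m - 1})"
    unfolding closing_color using ab a b assms by (intro col_notin[of _ _ i]) auto
  ultimately have "rainbow_cycle c (Suc (1 + 1 + 1 + (s - 2)))"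
    using assms by (intro path_close) auto
  moreover have "Suc (1 + 1 + 1 + (s - 2)) = s + 2" using assms by simp
  ultimately show False using assms by simp
qed

text \<open>If the chord at \<open>i\<close> has neither colour, overlap forces the chord at
  \<open>i + N\<close> to have its lowest colour. This propagates in steps of \<open>N\<close>,
  since that chord cannot also have its highest colour, and returns to \<open>i\<close> after
  \<open>m\<close> steps.\<close>

lemma chord_color_tight:
  assumes "\<not> rainbow_cycle c (N + 2)" "1 \<le> N"
    and "\<not> rainbow_cycle c (s + 2)" "m = s + 2 * N" "2 \<le> s"
  shows "c {V i, V (i + int N + 1)} = col i \<or> c {V i, V (i + int N + 1)} = col (i + int N)"
proof (rule ccontr)
  assume no: "\<not> ?thesis"
  have *: "c {V (i + int (Suc j) * int N), V (i + int (Suc j) * int N + int N + 1)}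
      = col (i + int (Suc j) * int N)" for j
  proof (induction j)
    case 0
    show ?case using color_at_overlap[OF assms, of i] no by (auto simp: algebra_simps)
  next
    case (Suc j)
    let ?a = "i + int (Suc j) * int N"
    have "col ?a \<noteq> col (?a + int N)"
      using inj_onD[OF col_inj[of ?a], of ?a "?a + int N"] assms by auto
    then show ?case using color_at_overlap[OF assms, of ?a] Suc by (auto simp: algebra_simps)
  qed
  have m: "Suc (m - 1) = m" using assms by simp
  have eq: "V (i + int m * int N + k) = V (i + k)" for k by (simp add: V_eq_iff)
  have "c {V i, V (i + int N + 1)} = col i"
    using *[of "m - 1"] eq[of 0] eq[of "int N + 1"] eq[of 1]
    unfolding m col_def by (simp add: add.assoc)
  then show False using no by simp
qed

section \<open>Shortcuts that save \<open>N - 1\<close> edges, where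
  \<open>N = 2 * f - 1\<close>\<close>

lemma shortcut_low:
  assumes omit: "\<not> rainbow_cycle c (2 * f + 1)" and f: "2 \<le> f" "4 * f \<le> m"
    and z: "c {V z, V (z + 2 * int f)} = col z"
    and y: "c {V (z - int f), V (z + int f)} = col (z - int f) \<or>
      c {V (z - int f), V (z + int f)} = col (z + int f - 1)"
  shows "path {z - int f..z + 2 * int f} {z - int f..<z + 2 * int f} (z - int f) (z + 2 * int f) (f + 2)"
proof -
  define x where "x = z - int f + 1"
  have zx: "z = x + int f - 1" by (simp add: x_def)
  have R1: "path {x..z} {x..<z} x z (f - 1)"
    using path_run[of "f - 1" x] f by (simp add: zx of_nat_diff algebra_simps)
  have R2: "path {z, z + 2 * int f} {z} z (z + 2 * int f) 1"
    using z f by (intro path_edge) auto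
  have R3: "path {z + int f..z + 2 * int f} {z + int f..<z + 2 * int f} (z + int f) (z + 2 * int f) f"
    using path_run[of f "z + int f"] f by (simp add: algebra_simps)
  have R12: "path ({x..z} \<union> {z, z + 2 * int f}) ({x..<z} \<union> {z}) x (z + 2 * int f) (f - 1 + 1)"
    using f by (intro path_trans[OF R1 R2, of x]) (auto simp: zx)
  have "path ({x..z} \<union> {z, z + 2 * int f} \<union> {z + int f..z + 2 * int f})
      ({x..<z} \<union> {z} \<union> {z + int f..<z + 2 * int f}) x (z + int f) (f - 1 + 1 + f)"
    using f by (intro path_trans[OF R12 path_sym[OF R3], of x]) (auto simp: zx)
  moreover have "Suc (f - 1 + 1 + f) = 2 * f + 1" "2 \<le> f - 1 + 1 + f" using f by auto
  \<comment> \<open>The path just built has \<open>2 * f\<close> edges, so its closing edge must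
    repeat one of its colours.\<close>
  ultimately have "c {V (z + int f), V x} \<in> col ` ({x..<z} \<union> {z} \<union> {z + int f..<z + 2 * int f})"
    using path_close omit by metis
  then obtain g where "c {V (z + int f), V x} = col g" "g \<in> {x..<z} \<union> {z} \<union> {z + int f..<z + 2 * int f}"
    by blast
  moreover have "x \<le> z" using f by (simp add: zx)
  ultimately have g: "c {V x, V (z + int f)} = col g"
      "x \<le> g \<and> g \<le> z \<or> z + int f \<le> g \<and> g < z + 2 * int f"
    by (auto simp: insert_commute)
  have E: "path {x, z + int f} {g} x (z + int f) 1"
    using g f by (intro path_edge) (auto simp: zx)
  show ?thesis
  proof (cases "g \<le> z")
    \<comment> \<open>Here the route is \<open>x - 1, x, z + f, ..., z + 2 * f\<close>, with
      \<open>g\<close> taken from the skipped edges.\<close>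
    case True
    have S: "path {x - 1, x} {x - 1} (x - 1) x 1"
      using f by (intro path_edge) (auto simp: col_def)
    have SE: "path ({x - 1, x} \<union> {x, z + int f}) ({x - 1} \<union> {g}) (x - 1) (z + int f) (1 + 1)"
      using f g True by (intro path_trans[OF S E, of "x - 1"]) (auto simp: zx)
    have "path ({x - 1, x} \<union> {x, z + int f} \<union> {z + int f..z + 2 * int f})
        ({x - 1} \<union> {g} \<union> {z + int f..<z + 2 * int f}) (x - 1) (z + 2 * int f) (1 + 1 + f)"
      using f g True by (intro path_trans[OF SE R3, of "x - 1"]) (auto simp: zx)
    then show ?thesis by (rule path_mono) (use f g True in \<open>auto simp: zx\<close>)
  next
    \<comment> \<open>Here the route is \<open>x - 1, z + f, x, ..., z, z + 2 * f\<close>. Both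
      possible values of \<open>d\<close> lie outside \<open>{x..z}\<close> and below
      \<open>g\<close>.\<close>
    case False
    obtain d where d: "c {V (x - 1), V (z + int f)} = col d" "d = x - 1 \<or> d = z + int f - 1"
      using y by (auto simp: zx)
    have S: "path {x - 1, z + int f} {d} (x - 1) (z + int f) 1"
      using d f by (intro path_edge) (auto simp: zx)
    have SE: "path ({x - 1, z + int f} \<union> {x, z + int f}) ({d} \<union> {g}) (x - 1) x (1 + 1)"
      using f g False d by (intro path_trans[OF S path_sym[OF E], of "x - 1"]) (auto simp: zx)
    have "path ({x - 1, z + int f} \<union> {x, z + int f} \<union> ({x..z} \<union> {z, z + 2 * int f}))
        ({d} \<union> {g} \<union> ({x..<z} \<union> {z})) (x - 1) (z + 2 * int f) (1 + 1 + (f - 1 + 1))"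
      using f g False d by (intro path_trans[OF SE R12, of "x - 1"]) (auto simp: zx)
    then show ?thesis by (rule path_mono) (use f g False d in \<open>auto simp: zx\<close>)
  qed
qed

lemma reflect: "periodic_rainbow_cycle c m (\<lambda>i. V (- i))"
proof
  fix i j
  show "V (- i) = V (- j) \<longleftrightarrow> int m dvd i - j"
    using dvd_minus_iff[of "int m" "i - j"] by (simp add: V_eq_iff)
  show "c {V (- i), V (- (i + 1))} = c {V (- j), V (- (j + 1))} \<longleftrightarrow> int m dvd i - j"
    using color_eq_iff[of "- i - 1" "- j - 1"] dvd_minus_iff[of "int m" "i - j"]
    by (simp add: insert_commute)
qed

lemma shortcut_high:
  assumes omit: "\<not> rainbow_cycle c (2 * f + 1)" and f: "2 \<le> f" "4 * f \<le> m"
    and z: "c {V z, V (z + 2 * int f)} = col (z + 2 * int f - 1)"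
    and y: "c {V (z + int f), V (z + 3 * int f)} = col (z + int f) \<or>
      c {V (z + int f), V (z + 3 * int f)} = col (z + 3 * int f - 1)"
  shows "path {z..z + 3 * int f} {z..<z + 3 * int f} z (z + 3 * int f) (f + 2)"
proof -
  interpret R: periodic_rainbow_cycle c m "\<lambda>i. V (- i)" by (rule reflect)
  have col': "R.col i = col (- i - 1)" for i
    by (simp add: R.col_def col_def insert_commute)
  \<comment> \<open>Reflection sends edge \<open>i\<close> to edge \<open>- i - 1\<close>, so the
    chord from \<open>z\<close> becomes one starting at \<open>?w\<close> and its highest colour
    becomes the lowest.\<close>
  let ?w = "- z - 2 * int f"
  have "R.path {?w - int f..?w + 2 * int f} {?w - int f..<?w + 2 * int f}
      (?w - int f) (?w + 2 * int f) (f + 2)"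
    by (rule R.shortcut_low) (use assms in \<open>auto simp: col' insert_commute algebra_simps\<close>)
  moreover have "(\<lambda>i. V (- i)) ` {?w - int f..?w + 2 * int f} = V ` {z..z + 3 * int f}"
    unfolding image_image[of V uminus, symmetric] image_uminus_atLeastAtMost
    by (simp add: algebra_simps)
  moreover have "R.col ` {?w - int f..<?w + 2 * int f} \<subseteq> col ` {z..<z + 3 * int f}"
    by (auto simp: col')
  ultimately have "path {z..z + 3 * int f} {z..<z + 3 * int f} (z + 3 * int f) z (f + 2)"
    unfolding R.path_def path_def by (auto elim!: rainbow_path_mono simp: algebra_simps)
  then show ?thesis by (rule path_sym)
qed

text \<open>The two kinds of shortcut occupy different stretches of \<open>3 * f\<close> edges.
  Padding by a run of \<open>f\<close> edges on one side fits both into the same window, chosen in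
  advance.\<close>

lemma shortcut:
  assumes omit: "\<not> rainbow_cycle c (2 * f + 1)" and f: "2 \<le> f" "4 * f < m"
    and tight: "\<And>i. c {V i, V (i + 2 * int f)} = col i \<or>
      c {V i, V (i + 2 * int f)} = col (i + 2 * int f - 1)"
  shows "path {u..u + 4 * int f} {u..<u + 4 * int f} u (u + 4 * int f) (2 * f + 2)"
proof -
  let ?z = "u + int f"
  have lo: "path {u..u + int f} {u..<u + int f} u (u + int f) f"
    using path_run[of f u] f by simp
  have hi: "path {u + 3 * int f..u + 4 * int f} {u + 3 * int f..<u + 4 * int f}
      (u + 3 * int f) (u + 4 * int f) f"
    using path_run[of f "u + 3 * int f"] f by (simp add: algebra_simps)
  consider "c {V ?z, V (?z + 2 * int f)} = col ?z"
    | "c {V ?z, V (?z + 2 * int f)} = col (?z + 2 * int f - 1)"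
    using tight[of ?z] by blast
  then show ?thesis
  proof cases
    case 1
    have "path {u..u + 3 * int f} {u..<u + 3 * int f} u (u + 3 * int f) (f + 2)"
      using shortcut_low[OF omit _ _ 1] tight[of u] f by (simp add: algebra_simps)
    then have "path ({u..u + 3 * int f} \<union> {u + 3 * int f..u + 4 * int f})
        ({u..<u + 3 * int f} \<union> {u + 3 * int f..<u + 4 * int f}) u (u + 4 * int f) (f + 2 + f)"
      using f by (intro path_trans[OF _ hi, of _ _ _ _ u]) auto
    then show ?thesis by (rule path_mono) auto
  next
    case 2
    have "path {u + int f..u + 4 * int f} {u + int f..<u + 4 * int f}
        (u + int f) (u + 4 * int f) (f + 2)"
      using shortcut_high[OF omit _ _ 2] tight[of "?z + int f"] f by (simp add: algebra_simps)
    then have "path ({u..u + int f} \<union> {u + int f..u + 4 * int f})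
        ({u..<u + int f} \<union> {u + int f..<u + 4 * int f}) u (u + 4 * int f) (f + (f + 2))"
      using f by (intro path_trans[OF lo, of _ _ _ _ u]) auto
    then show ?thesis by (rule path_mono) auto
  qed
qed

end

section \<open>Closure properties of the omitted lengths\<close>

lemma rainbow_cycle_imp_periodic:
  assumes "rainbow_cycle c m"
  obtains V where "periodic_rainbow_cycle c m V"
proof -
  obtain v where m: "3 \<le> m" and v: "inj_on v {..<m}"
      "inj_on (\<lambda>i. c {v i, v ((i + 1) mod m)}) {..<m}"
    using assms unfolding rainbow_cycle_def by blast
  define r where "r i = nat (i mod int m)" for i
  have r: "r i < m" for i using m by (simp add: r_def nat_less_iff)
  have r_eq: "r i = r j \<longleftrightarrow> int m dvd i - j" for i j
    using m by (simp add: r_def eq_nat_nat_iff mod_eq_dvd_iff)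
  have r_Suc: "r (i + 1) = (r i + 1) mod m" for i
  proof -
    have "int (r (i + 1)) = int ((r i + 1) mod m)"
      using m by (simp add: r_def zmod_int mod_simps add.commute)
    then show ?thesis by linarith
  qed
  have "periodic_rainbow_cycle c m (v \<circ> r)"
  proof
    fix i j
    show "(v \<circ> r) i = (v \<circ> r) j \<longleftrightarrow> int m dvd i - j"
      using v(1) r r_eq by (metis comp_apply inj_onD lessThan_iff)
    show "c {(v \<circ> r) i, (v \<circ> r) (i + 1)} = c {(v \<circ> r) j, (v \<circ> r) (j + 1)} \<longleftrightarrow> int m dvd i - j"
      using inj_on_eq_iff[OF v(2), of "r i" "r j"] r[of i] r[of j] r_eq[of i j] r_Suc by simp
  qed
  then show ?thesis by (rule that)
qed

lemma no_rainbow_cycle_add: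
  assumes "\<not> rainbow_cycle c (N + 2)" "1 \<le> N" "\<not> rainbow_cycle c (s + 2)" "1 \<le> s"
  shows "\<not> rainbow_cycle c (s + N + 2)"
proof
  assume "rainbow_cycle c (s + N + 2)"
  then obtain V where "periodic_rainbow_cycle c (s + N + 2) V" by (rule rainbow_cycle_imp_periodic)
  then interpret periodic_rainbow_cycle c "s + N + 2" V .
  obtain j where j: "0 \<le> j" "j \<le> int N" "c {V 0, V (int N + 1)} = col j"
    using chord_color[of N 0] assms by auto
  have P: "path {0, int N + 1} {j} 0 (int N + 1) 1"
    using j by (intro path_edge) auto
  have Q: "path {int N + 1..int N + 1 + int s} {int N + 1..<int N + 1 + int s}
      (int N + 1) (int N + 1 + int s) s"
    by (rule path_run) auto
  have "path ({0, int N + 1} \<union> {int N + 1..int N + 1 + int s})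
      ({j} \<union> {int N + 1..<int N + 1 + int s}) 0 (int N + 1 + int s) (1 + s)"
    using j by (intro path_trans[OF P Q, of 0]) auto
  moreover have "c {V (int N + 1 + int s), V 0} = col (int N + 1 + int s)"
    using closing_color[of 0] by (simp add: algebra_simps)
  moreover have "col (int N + 1 + int s) \<notin> col ` ({j} \<union> {int N + 1..<int N + 1 + int s})"
    using j by (intro col_notin[of _ _ 0]) auto
  ultimately have "rainbow_cycle c (Suc (1 + s))"
    using assms(4) path_close by simp
  then show False using assms by simp
qed

text \<open>Two adjacent windows of \<open>4 * f\<close> edges each save \<open>2 * f - 2\<close>
  edges. The bound on \<open>s\<close> gives \<open>m >= 8 * f + 1\<close>, so both fit and an edge
  is left to close the cycle.\<close>

lemma no_rainbow_cycle_step: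
  assumes omit: "\<not> rainbow_cycle c (2 * f + 1)" "2 \<le> f"
    and s: "\<not> rainbow_cycle c (s + 2)" "4 * f + 3 \<le> s"
  shows "\<not> rainbow_cycle c (s + (4 * f - 4) + 2)"
proof
  define m where "m = s + 2 * (2 * f - 1)"
  have "s + (4 * f - 4) + 2 = m" using omit by (simp add: m_def)
  moreover assume "rainbow_cycle c (s + (4 * f - 4) + 2)"
  ultimately obtain V where "periodic_rainbow_cycle c m V" using rainbow_cycle_imp_periodic by metis
  then interpret periodic_rainbow_cycle c m V .
  have N: "int (2 * f - 1) = 2 * int f - 1" "2 * f - 1 + 2 = 2 * f + 1" using omit by auto
  have m: "int m = int s + 4 * int f - 2" using omit by (simp add: m_def)
  have tight: "c {V i, V (i + 2 * int f)} = col i \<or>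
      c {V i, V (i + 2 * int f)} = col (i + 2 * int f - 1)" for i
    using chord_color_tight[of "2 * f - 1" s i] omit s unfolding N by (simp add: m_def algebra_simps)
  have P: "path {u..u + 4 * int f} {u..<u + 4 * int f} u (u + 4 * int f) (2 * f + 2)" for u
    using shortcut[OF omit _ tight] s omit by (simp add: m_def)
  have P1: "path {0..4 * int f} {0..<4 * int f} 0 (4 * int f) (2 * f + 2)"
    using P[of 0] by simp
  have P2: "path {4 * int f..8 * int f} {4 * int f..<8 * int f} (4 * int f) (8 * int f) (2 * f + 2)"
    using P[of "4 * int f"] by simp
  have P12: "path ({0..4 * int f} \<union> {4 * int f..8 * int f})
      ({0..<4 * int f} \<union> {4 * int f..<8 * int f}) 0 (8 * int f) (2 * f + 2 + (2 * f + 2))"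
    using s m by (intro path_trans[OF P1 P2, of 0]) auto
  have P3: "path {8 * int f..int m - 1} {8 * int f..<int m - 1} (8 * int f) (int m - 1) (m - 1 - 8 * f)"
  proof -
    have "m - 1 - 8 * f < m" "8 * int f + int (m - 1 - 8 * f) = int m - 1" using s m by auto
    then show ?thesis using path_run[of "m - 1 - 8 * f" "8 * int f"] by simp
  qed
  have P123: "path ({0..4 * int f} \<union> {4 * int f..8 * int f} \<union> {8 * int f..int m - 1})
      ({0..<4 * int f} \<union> {4 * int f..<8 * int f} \<union> {8 * int f..<int m - 1})
      0 (int m - 1) (2 * f + 2 + (2 * f + 2) + (m - 1 - 8 * f))"
    using s m by (intro path_trans[OF P12 P3, of 0]) auto
  have closing: "c {V (int m - 1), V 0} = col (int m - 1)"
    using closing_color[of 0] by simp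
  have "c {V (int m - 1), V 0} \<notin>
      col ` ({0..<4 * int f} \<union> {4 * int f..<8 * int f} \<union> {8 * int f..<int m - 1})"
    unfolding closing using s m by (intro col_notin[of _ _ 0]) auto
  then have "rainbow_cycle c (Suc (2 * f + 2 + (2 * f + 2) + (m - 1 - 8 * f)))"
    by (rule path_close[OF P123, rotated]) simp
  moreover have "Suc (2 * f + 2 + (2 * f + 2) + (m - 1 - 8 * f)) = s + 2"
    using s omit by (simp add: m_def)
  ultimately show False using s by simp
qed

section \<open>Reaching every large length\<close>

lemma no_rainbow_cycle_mult:
  assumes "\<not> rainbow_cycle c (N + 2)" "1 \<le> N"
  shows "\<not> rainbow_cycle c (Suc j * N + 2)"
proof (induction j)
  case 0 then show ?case using assms by simp
next
  case (Suc j)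
  have "\<not> rainbow_cycle c (Suc j * N + N + 2)"
    using no_rainbow_cycle_add[OF assms Suc] assms by simp
  then show ?case by (simp add: algebra_simps)
qed

lemma no_rainbow_cycle_combination:
  assumes "\<not> rainbow_cycle c (2 * f + 1)" "2 \<le> f" "4 \<le> j"
  shows "\<not> rainbow_cycle c (j * (2 * f - 1) + t * (4 * f - 4) + 2)"
proof (induction t)
  case 0
  have "2 * f - 1 + 2 = 2 * f + 1" "Suc (j - 1) = j" using assms by auto
  then show ?case using no_rainbow_cycle_mult[of c "2 * f - 1" "j - 1"] assms by simp
next
  case (Suc t)
  \<comment> \<open>Four multiples of \<open>2 * f - 1\<close> reach the threshold
    \<open>4 * f + 3\<close> for every \<open>f >= 2\<close>; three would fail at
    \<open>f = 2\<close>.\<close>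
  have "4 * (2 * f - 1) \<le> j * (2 * f - 1)" using assms by (intro mult_right_mono) auto
  then have "4 * f + 3 \<le> j * (2 * f - 1) + t * (4 * f - 4)" using assms by linarith
  moreover have "j * (2 * f - 1) + t * (4 * f - 4) + (4 * f - 4) = j * (2 * f - 1) + Suc t * (4 * f - 4)"
    by simp
  ultimately show ?case using no_rainbow_cycle_step[OF assms(1,2) Suc] by simp
qed

theorem theorem5:
  fixes c :: "'a set \<Rightarrow> 'c" and n m :: nat
  assumes "odd n" and "3 \<le> n"
    and "\<not> rainbow_cycle c n"
    and "m \<ge> 2 * n ^ 2"
  shows "\<not> rainbow_cycle c m"
proof -
  obtain f where f: "n = 2 * f + 1" using assms(1) by (auto elim: oddE)
  have big: "8 * (f * f) + 8 * f + 2 \<le> m"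
    using assms(4) by (simp add: f power2_eq_square algebra_simps)
  show ?thesis
  proof (cases "f = 1")
    \<comment> \<open>Here \<open>N = 1\<close>, so multiples of \<open>N\<close> already give every
      length.\<close>
    case True
    have "Suc (m - 3) * 1 + 2 = m" using big True by simp
    then show ?thesis using no_rainbow_cycle_mult[of c 1 "m - 3"] assms(3)
      by (simp add: f True numeral_3_eq_3)
  next
    case False
    then have f2: "2 \<le> f" using assms(2) f by simp
    define N where "N = 2 * f - 1"
    have N: "3 \<le> N" "2 * f = N + 1" using f2 by (auto simp: N_def)
    define a where "a = N - (m - 2) mod N"
    have a: "a + (m - 2) mod N = N" using N by (simp add: a_def)
    \<comment> \<open>\<open>f\<close> is the inverse of \<open>2\<close> modulo \<open>N\<close>, so \<open>2 t \<equiv> a \<equiv> - (m - 2)\<close>.\<close>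
    define t where "t = a * f mod N"
    have "(2 * t + (m - 2)) mod N = 0"
    proof -
      have "2 * t mod N = 2 * (a * f) mod N"
        unfolding t_def by (rule mod_mult_right_eq)
      also have "2 * (a * f) = a * N + a"
        using N(2) by (simp add: mult.left_commute[of 2])
      finally have "(2 * t + (m - 2)) mod N = (a * N + a + (m - 2) mod N) mod N"
        by (rule mod_add_cong) simp
      also have "a * N + a + (m - 2) mod N = a * N + N" using a by simp
      finally show ?thesis by simp
    qed
    then obtain l where l: "2 * t + (m - 2) = N * l" by blast
    have tN: "t \<le> N - 1" using N by (simp add: t_def less_Suc_eq_le[symmetric])
    \<comment> \<open>The left side is \<open>2 * n ^ 2\<close> with
      \<open>n = N + 2\<close>.\<close>
    have m: "2 * (N * N) + 8 * N + 8 \<le> m"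
    proof -
      have "8 * (f * f) + 8 * f + 2 = 2 * ((2 * f) * (2 * f)) + 4 * (2 * f) + 2" by simp
      then show ?thesis using big unfolding N(2) by (simp add: algebra_simps)
    qed
    \<comment> \<open>This is where the quadratic bound enters: otherwise
      \<open>m - 2 <= N * l <= 2 * N ^ 2 + N\<close>.\<close>
    have "2 * t + 4 \<le> l"
    proof (rule ccontr)
      assume "\<not> ?thesis"
      then have "l \<le> 2 * N + 1" using tN N by linarith
      then have "N * l \<le> N * (2 * N + 1)" by (rule mult_left_mono) simp
      then show False using l m by (simp add: algebra_simps)
    qed
    then obtain j where j: "l = 2 * t + j" "4 \<le> j" using that[of "l - 2 * t"] by simp
    \<comment> \<open>As \<open>4 * f - 4 = 2 * N - 2\<close>, the equation for \<open>l\<close>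
      turns into \<open>m - 2 = j * N + t * (2 * N - 2)\<close>.\<close>
    have "t * (4 * f - 4) + 2 * t = 2 * t * N"
    proof -
      have "4 * f - 4 + 2 = 2 * N" using f2 by (simp add: N_def)
      then have "t * (4 * f - 4 + 2) = t * (2 * N)" by simp
      then show ?thesis by (simp add: algebra_simps)
    qed
    then have "j * N + t * (4 * f - 4) + 2 = m"
      using l m unfolding j by (simp add: algebra_simps)
    then show ?thesis
      using no_rainbow_cycle_combination[OF _ f2 j(2), of c t] assms(3) by (simp add: f N_def)
  qed
qed

end
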